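(* Let $A$ be a finite abelian group. Then the group $A \wr \mathbb{Z}$ admits a pointy action.
   Context: For a finite alphabet $\Sigma$, the full shift $\Sigma^{\mathbb{Z}}$ carries the product topology and the shift homeomorphism $\sigma(x)_i = x_{i+1}$; $\mathrm{Aut}(\Sigma^{\mathbb{Z}})$ is the group of homeomorphisms of $\Sigma^{\mathbb{Z}}$ commuting with $\sigma$. If $\Sigma$ contains a distinguished symbol $0$, then $\mathrm{Aut}_0(\Sigma^{\mathbb{Z}})$ is the stabilizer of the constant point $0^{\mathbb{Z}}$ in $\mathrm{Aut}(\Sigma^{\mathbb{Z}})$, and $x\in\Sigma^{\mathbb{Z}}$ is $0$-finite if $\{i\in\mathbb{Z} : x_i\neq 0\}$ is finite. A subgroup $H\le \mathrm{Aut}_0(\Sigma^{\mathbb{Z}})$ is pointy if some $0$-finite $x_0\in\Sigma^{\mathbb{Z}}$ has free orbit under $H$, i.e. $h\mapsto hx_0$ is injective on $H$. A group $G$ admits a pointy action if, for some finite alphabet $\Sigma\ni 0$, there is an embedding of $G$ into $\mathrm{Aut}_0(\Sigma^{\mathbb{Z}})$ whose image is pointy. The wreath product $A\wr\mathbb{Z}$ is the restricted one: the semidirect product $A^{(\mathbb{Z})}\rtimes\mathbb{Z}$, where $A^{(\mathbb{Z})}$ is the group of finitely supported functions $\mathbb{Z}\to A$ and $\mathbb{Z}$ acts by translating coordinates. *)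

theory Defs
  imports
    "HOL-Analysis.Analysis"
    "HOL-Algebra.Bij"
    "HOL-Algebra.Group_Action"
    "HOL-Algebra.Elementary_Groups"
    "HOL-Algebra.Product_Groups"
begin

definition full_shift :: "'s set \<Rightarrow> (int \<Rightarrow> 's) topology" where
  "full_shift S = product_topology (\<lambda>_. discrete_topology S) UNIV"

definition shift :: "(int \<Rightarrow> 's) \<Rightarrow> int \<Rightarrow> 's" where
  "shift x = (\<lambda>i. x (i + 1))"

(* Automorphisms are taken as elements of BijGroup, hence extensional, so that each
   self-map of the full shift is represented by exactly one HOL function. *)
definition aut_shift :: "'s set \<Rightarrow> ((int \<Rightarrow> 's) \<Rightarrow> (int \<Rightarrow> 's)) monoid" where
  "aut_shift S = (BijGroup (topspace (full_shift S)))
     \<lparr>carrier := {f \<in> Bij (topspace (full_shift S)).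
        homeomorphic_map (full_shift S) (full_shift S) f \<and>
        (\<forall>x \<in> topspace (full_shift S). f (shift x) = shift (f x))}\<rparr>"

definition aut_shift0 :: "'s set \<Rightarrow> 's \<Rightarrow> ((int \<Rightarrow> 's) \<Rightarrow> (int \<Rightarrow> 's)) monoid" where
  "aut_shift0 S z = (aut_shift S)\<lparr>carrier := stabilizer (aut_shift S) (\<lambda>f. f) (\<lambda>_. z)\<rparr>"

definition zero_finite :: "'s \<Rightarrow> (int \<Rightarrow> 's) \<Rightarrow> bool" where
  "zero_finite z x \<longleftrightarrow> finite {i. x i \<noteq> z}"

definition pointy :: "'s set \<Rightarrow> 's \<Rightarrow> ((int \<Rightarrow> 's) \<Rightarrow> (int \<Rightarrow> 's)) set \<Rightarrow> bool" where
  "pointy S z H \<longleftrightarrow> subgroup H (aut_shift0 S z) \<and>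
     (\<exists>x \<in> topspace (full_shift S). zero_finite z x \<and> inj_on (\<lambda>h. h x) H)"

(* Every finite alphabet is in bijection with a finite set of natural numbers, so
   quantifying over the latter loses no generality. *)
definition admits_pointy_action :: "('g, 'm) monoid_scheme \<Rightarrow> bool" where
  "admits_pointy_action G \<longleftrightarrow>
     (\<exists>(S :: nat set) z \<phi>. finite S \<and> z \<in> S \<and>
        \<phi> \<in> mon G (aut_shift0 S z) \<and> pointy S z (\<phi> ` carrier G))"

definition semidirect_product ::
  "('n, 'k) monoid_scheme \<Rightarrow> ('h, 'm) monoid_scheme \<Rightarrow> ('h \<Rightarrow> 'n \<Rightarrow> 'n) \<Rightarrow> ('n \<times> 'h) monoid"
  where
  "semidirect_product N H \<alpha> =
     \<lparr>carrier = carrier N \<times> carrier H,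
      monoid.mult = (\<lambda>(n, h) (n', h'). (n \<otimes>\<^bsub>N\<^esub> \<alpha> h n', h \<otimes>\<^bsub>H\<^esub> h')),
      one = (\<one>\<^bsub>N\<^esub>, \<one>\<^bsub>H\<^esub>)\<rparr>"

definition translate :: "int \<Rightarrow> (int \<Rightarrow> 'a) \<Rightarrow> int \<Rightarrow> 'a" where
  "translate k f = (\<lambda>i. f (i - k))"

definition wreath_int :: "('a, 'm) monoid_scheme \<Rightarrow> ((int \<Rightarrow> 'a) \<times> int) monoid" where
  "wreath_int A = semidirect_product (sum_group UNIV (\<lambda>_. A)) integer_group translate"

lemma topspace_full_shift: "topspace (full_shift S) = {x. \<forall>i. x i \<in> S}"
  by (auto simp: full_shift_def)

lemma group_aut_shift: "group (aut_shift S)"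
proof -
  let ?T = "full_shift S"
  let ?X = "topspace ?T"
  let ?C = "{f \<in> Bij ?X. homeomorphic_map ?T ?T f \<and> (\<forall>x \<in> ?X. f (shift x) = shift (f x))}"
  interpret B: group "BijGroup ?X" by (rule group_BijGroup)
  have shX: "shift x \<in> ?X" if "x \<in> ?X" for x
    using that by (auto simp: topspace_full_shift shift_def)
  have "subgroup ?C (BijGroup ?X)"
  proof (rule B.subgroupI)
    show "?C \<subseteq> carrier (BijGroup ?X)" by (auto simp: BijGroup_def)
    have "homeomorphic_map ?T ?T (\<lambda>x\<in>?X. x)"
      by (rule homeomorphic_map_eq[OF homeomorphic_map_id[THEN iffD2, OF refl]]) auto
    then have "(\<lambda>x\<in>?X. x) \<in> ?C" using shX by (auto simp: id_Bij)
    then show "?C \<noteq> {}" by blast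
  next
    fix f assume f: "f \<in> ?C"
    then have fB: "f \<in> Bij ?X" and fh: "homeomorphic_map ?T ?T f" by auto
    have bij: "bij_betw f ?X ?X" using fB by (simp add: Bij_def)
    let ?g = "restrict (inv_into ?X f) ?X"
    have inv: "inv\<^bsub>BijGroup ?X\<^esub> f = ?g"
      using inv_BijGroup[OF fB] by simp
    obtain g where g: "homeomorphic_maps ?T ?T f g"
      using fh by (auto simp: homeomorphic_map_maps)
    have gX: "g y \<in> ?X" and fg: "f (g y) = y" if "y \<in> ?X" for y
      using g that by (auto simp: homeomorphic_maps_def continuous_map_def)
    have ge: "?g y = g y" if "y \<in> ?X" for y
      using gX[OF that] fg[OF that] bij that
      by (metis bij_betw_def inv_into_f_f restrict_apply')
    have "homeomorphic_map ?T ?T g"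
      using g homeomorphic_maps_map homeomorphic_maps_sym by blast
    then have "homeomorphic_map ?T ?T ?g"
      by (rule homeomorphic_map_eq) (rule ge[symmetric])
    moreover have "?g (shift y) = shift (?g y)" if y: "y \<in> ?X" for y
    proof -
      have "f (shift (g y)) = shift y" using f gX[OF y] fg[OF y] by auto
      then have "f (shift (g y)) = f (g (shift y))" using fg[OF shX[OF y]] by simp
      then have "shift (g y) = g (shift y)"
        using bij shX gX y unfolding bij_betw_def inj_on_def by blast
      then show ?thesis using ge y shX by metis
    qed
    moreover have "?g \<in> Bij ?X" by (rule restrict_inv_into_Bij[OF fB])
    ultimately show "inv\<^bsub>BijGroup ?X\<^esub> f \<in> ?C" unfolding inv by blast
  next
    fix f g assume f: "f \<in> ?C" and g: "g \<in> ?C"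
    have m: "f \<otimes>\<^bsub>BijGroup ?X\<^esub> g = compose ?X f g"
      using f g by (simp add: BijGroup_def)
    have gX: "g x \<in> ?X" if "x \<in> ?X" for x
      using g that Bij_imp_funcset[of g] by auto
    have "homeomorphic_map ?T ?T (f \<circ> g)"
      using f g homeomorphic_map_compose by blast
    then have "homeomorphic_map ?T ?T (compose ?X f g)"
      by (rule homeomorphic_map_eq) (simp add: compose_def)
    then show "f \<otimes>\<^bsub>BijGroup ?X\<^esub> g \<in> ?C"
      unfolding m using f g gX shX compose_Bij[of f ?X g] by (simp add: compose_eq)
  qed
  then show ?thesis
    unfolding aut_shift_def by (rule subgroup.subgroup_is_group) (rule group_BijGroup)
qed

lemma group_aut_shift0:
  assumes "z \<in> S"
  shows "group (aut_shift0 S z)"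
proof -
  let ?X = "topspace (full_shift S)"
  interpret G: group "aut_shift S" by (rule group_aut_shift)
  have zX: "(\<lambda>_. z) \<in> ?X" using assms by (simp add: topspace_full_shift)
  have one: "\<one>\<^bsub>aut_shift S\<^esub> = (\<lambda>x\<in>?X. x)"
    by (simp add: aut_shift_def BijGroup_def)
  have mult: "(f \<otimes>\<^bsub>aut_shift S\<^esub> g) (\<lambda>_. z) = f (g (\<lambda>_. z))"
    if "f \<in> carrier (aut_shift S)" "g \<in> carrier (aut_shift S)" for f g
    using that zX by (simp add: aut_shift_def BijGroup_def compose_def)
  have "subgroup (stabilizer (aut_shift S) (\<lambda>f. f) (\<lambda>_. z)) (aut_shift S)"
  proof (rule G.subgroupI)
    show "stabilizer (aut_shift S) (\<lambda>f. f) (\<lambda>_. z) \<noteq> {}"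
      using G.one_closed zX one by (auto simp: stabilizer_def)
  next
    fix f assume f: "f \<in> stabilizer (aut_shift S) (\<lambda>f. f) (\<lambda>_. z)"
    then have fc: "f \<in> carrier (aut_shift S)" and fz: "f (\<lambda>_. z) = (\<lambda>_. z)"
      by (auto simp: stabilizer_def)
    have "(inv\<^bsub>aut_shift S\<^esub> f) (f (\<lambda>_. z)) = (\<lambda>_. z)"
      using mult[OF G.inv_closed[OF fc] fc] G.l_inv[OF fc] one zX by simp
    then show "inv\<^bsub>aut_shift S\<^esub> f \<in> stabilizer (aut_shift S) (\<lambda>f. f) (\<lambda>_. z)"
      using fc fz by (simp add: stabilizer_def)
  qed (auto simp: stabilizer_def mult)
  then show ?thesis
    unfolding aut_shift0_def by (rule subgroup.subgroup_is_group) (rule group_aut_shift)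
qed

lemma group_wreath_int:
  assumes "group A"
  shows "group (wreath_int A)"
proof -
  let ?N = "sum_group (UNIV :: int set) (\<lambda>_. A)"
  interpret A: group A by fact
  interpret N: group ?N by (rule sum_group) (rule assms)
  have tc: "translate k f \<in> carrier ?N" if "f \<in> carrier ?N" for k f
  proof -
    have "finite {i. f i \<noteq> \<one>\<^bsub>A\<^esub>}" using that assms by (simp add: carrier_sum_group)
    then have "finite ((\<lambda>i. i + k) ` {i. f i \<noteq> \<one>\<^bsub>A\<^esub>})" by simp
    moreover have "{i. f (i - k) \<noteq> \<one>\<^bsub>A\<^esub>} \<subseteq> (\<lambda>i. i + k) ` {i. f i \<noteq> \<one>\<^bsub>A\<^esub>}"
    proof
      fix i assume "i \<in> {i. f (i - k) \<noteq> \<one>\<^bsub>A\<^esub>}"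
      then show "i \<in> (\<lambda>i. i + k) ` {i. f i \<noteq> \<one>\<^bsub>A\<^esub>}"
        by (intro image_eqI[of _ _ "i - k"]) auto
    qed
    ultimately have "finite {i. f (i - k) \<noteq> \<one>\<^bsub>A\<^esub>}" by (rule finite_subset[rotated])
    then show ?thesis using that assms
      by (auto simp: carrier_sum_group translate_def PiE_iff)
  qed
  have tm: "translate k (f \<otimes>\<^bsub>?N\<^esub> g) = translate k f \<otimes>\<^bsub>?N\<^esub> translate k g" for k f g
    by (simp add: translate_def restrict_def)
  have tt: "translate k (translate l f) = translate (k + l) f" for k l and f :: "int \<Rightarrow> 'a"
    by (simp add: translate_def algebra_simps)
  have t1: "translate k \<one>\<^bsub>?N\<^esub> = \<one>\<^bsub>?N\<^esub>" for k by (simp add: translate_def restrict_def)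
  have t0: "translate 0 f = f" for f :: "int \<Rightarrow> 'a" by (simp add: translate_def)
  have c: "carrier (wreath_int A) = carrier ?N \<times> UNIV"
    by (simp add: wreath_int_def semidirect_product_def integer_group_def)
  have o: "\<one>\<^bsub>wreath_int A\<^esub> = (\<one>\<^bsub>?N\<^esub>, 0)"
    by (simp add: wreath_int_def semidirect_product_def integer_group_def)
  have m: "(f, k) \<otimes>\<^bsub>wreath_int A\<^esub> (g, l) = (f \<otimes>\<^bsub>?N\<^esub> translate k g, k + l)" for f g k l
    by (simp add: wreath_int_def semidirect_product_def integer_group_def)
  show ?thesis
  proof (rule groupI)
    show "x \<otimes>\<^bsub>wreath_int A\<^esub> y \<in> carrier (wreath_int A)"
      if "x \<in> carrier (wreath_int A)" "y \<in> carrier (wreath_int A)" for x y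
      using that N.m_closed tc by (cases x; cases y) (simp only: c m mem_Times_iff fst_conv snd_conv UNIV_I simp_thms)
    show "\<one>\<^bsub>wreath_int A\<^esub> \<in> carrier (wreath_int A)"
      using N.one_closed by (simp only: c o mem_Times_iff fst_conv snd_conv UNIV_I simp_thms)
    show "x \<otimes>\<^bsub>wreath_int A\<^esub> y \<otimes>\<^bsub>wreath_int A\<^esub> w = x \<otimes>\<^bsub>wreath_int A\<^esub> (y \<otimes>\<^bsub>wreath_int A\<^esub> w)"
      if "x \<in> carrier (wreath_int A)" "y \<in> carrier (wreath_int A)" "w \<in> carrier (wreath_int A)"
      for x y w
      using that N.m_assoc tc
      by (cases x; cases y; cases w)
        (simp only: c m mem_Times_iff fst_conv snd_conv tm tt add.assoc)
    show "\<one>\<^bsub>wreath_int A\<^esub> \<otimes>\<^bsub>wreath_int A\<^esub> x = x" if "x \<in> carrier (wreath_int A)" for x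
      using that N.l_one by (cases x) (simp only: c o m mem_Times_iff fst_conv snd_conv t0 add_0)
    show "\<exists>y\<in>carrier (wreath_int A). y \<otimes>\<^bsub>wreath_int A\<^esub> x = \<one>\<^bsub>wreath_int A\<^esub>"
      if "x \<in> carrier (wreath_int A)" for x
    proof -
      obtain f k where x: "x = (f, k)" by (cases x)
      have f: "f \<in> carrier ?N" using that by (simp only: x c mem_Times_iff fst_conv)
      show ?thesis
      proof
        show "(translate (- k) (inv\<^bsub>?N\<^esub> f), - k) \<otimes>\<^bsub>wreath_int A\<^esub> x = \<one>\<^bsub>wreath_int A\<^esub>"
          by (simp only: x m o tm[symmetric] N.l_inv[OF f] t1 left_minus)
        show "(translate (- k) (inv\<^bsub>?N\<^esub> f), - k) \<in> carrier (wreath_int A)"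
          using tc[OF N.inv_closed[OF f]] by (simp only: c mem_Times_iff fst_conv snd_conv UNIV_I simp_thms)
      qed
    qed
  qed
qed

end

theory Submission
  imports Defs "HOL-Algebra.Free_Abelian_Groups"
begin

text \<open>
  The alphabet is \<open>A \<times> bool\<close>, with distinguished symbol \<open>(\<one>, False)\<close>. A point of the full shift then
  consists of an \<open>A\<close>-valued track \<open>a\<close> and a track \<open>c\<close> of marks, that is, of a set of marked cells.
  The generator of \<open>\<int>\<close> moves the marks one step and leaves \<open>a\<close> in place, and an element of the copy
  of \<open>A\<close> at coordinate \<open>0\<close> multiplies \<open>a\<close> at each marked cell by that element. The conjugate of this
  copy by the \<open>j\<close>-th power of the generator acts instead at the cells that lie
  \<open>j\<close> steps to the left of a mark. As \<open>A\<close> is abelian, all these conjugates commute, so they give an action of \<open>A \<wr> \<int>\<close>: the pair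
  \<open>(f, k)\<close> moves the marks by \<open>k\<close> and then multiplies \<open>a\<^sub>i\<close> by the product of all \<open>f j\<close> for which the
  cell \<open>i + j\<close> carries a mark (\<open>mark_product\<close>). Only finitely many factors differ from \<open>\<one>\<close>, so the
  new symbol at \<open>i\<close> depends on finitely many cells, and this is the continuity of the action.

  The point with one mark at the origin and trivial \<open>A\<close>-track is \<open>0\<close>-finite. Its image under \<open>(f, k)\<close>
  has its only mark at \<open>k\<close>, and its \<open>A\<close>-track is \<open>i \<mapsto> f (k - i)\<close>; both \<open>k\<close> and \<open>f\<close> can be read off,
  so the orbit is free. Freeness of this orbit also makes the action faithful.
\<close>

section \<open>Pointy actions from explicit formulas\<close>

text \<open>
  This is the easy half of the Curtis--Hedlund--Lyndon theorem: fixing the symbols at the finitely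
  many cells in \<open>J\<close> cuts out a basic open set, on which the \<open>i\<close>-th symbol of the image is constant.
\<close>
lemma continuous_map_full_shift_local:
  assumes into: "\<And>x i. x \<in> topspace (full_shift S) \<Longrightarrow> F x i \<in> T"
    and local: "\<And>i. \<exists>J. finite J \<and> (\<forall>x\<in>topspace (full_shift S). \<forall>y\<in>topspace (full_shift S).
      (\<forall>j\<in>J. x j = y j) \<longrightarrow> F x i = F y i)"
  shows "continuous_map (full_shift S) (full_shift T) F"
proof -
  have "openin (full_shift S) {x \<in> topspace (full_shift S). F x i \<in> U}" for i U
  proof -
    obtain J where J: "finite J"
      "\<And>x y. \<lbrakk>x \<in> topspace (full_shift S); y \<in> topspace (full_shift S); \<forall>j\<in>J. x j = y j\<rbrakk>
        \<Longrightarrow> F x i = F y i"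
      using local[of i] by blast
    have "\<exists>V. finite {j. V j \<noteq> S} \<and> (\<forall>j. V j \<subseteq> S) \<and> x \<in> Pi\<^sub>E UNIV V \<and>
        Pi\<^sub>E UNIV V \<subseteq> {x \<in> topspace (full_shift S). F x i \<in> U}"
      if x: "x \<in> topspace (full_shift S)" "F x i \<in> U" for x
    proof (intro exI conjI)
      let ?V = "\<lambda>j. if j \<in> J then {x j} else S"
      show "finite {j. ?V j \<noteq> S}"
        by (rule finite_subset[OF _ J(1)]) auto
      show "\<forall>j. ?V j \<subseteq> S" "x \<in> Pi\<^sub>E UNIV ?V"
        using x by (auto simp: topspace_full_shift)
      show "Pi\<^sub>E UNIV ?V \<subseteq> {x \<in> topspace (full_shift S). F x i \<in> U}"
      proof
        fix y assume "y \<in> Pi\<^sub>E UNIV ?V"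
        then have y: "y j \<in> ?V j" for j by (auto simp: PiE_iff)
        have "y j \<in> S" for j
          using y[of j] x(1) by (auto simp: topspace_full_shift split: if_splits)
        moreover have "\<forall>j\<in>J. x j = y j"
        proof
          fix j assume "j \<in> J"
          then show "x j = y j" using y[of j] by simp
        qed
        moreover have "F x i = F y i" if "y \<in> topspace (full_shift S)" "\<forall>j\<in>J. x j = y j"
          using J(2)[OF x(1) that] .
        ultimately show "y \<in> {x \<in> topspace (full_shift S). F x i \<in> U}"
          using x(2) by (simp add: topspace_full_shift)
      qed
    qed
    then show ?thesis
      unfolding full_shift_def openin_product_topology_alt
      by (simp only: openin_discrete_topology topspace_discrete_topology UNIV_I simp_thms
          mem_Collect_eq Ball_def) iprover
  qed
  then show ?thesis
    using into unfolding full_shift_def[of T] continuous_map_componentwise_UNIV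
    by (auto simp: continuous_map_def)
qed

text \<open>
  An action given by formulas is rarely extensional and is most natural over a structured alphabet.
  The locale collects what has to be checked for the formulas; that this gives a pointy embedding
  into the automorphism group over an alphabet of numbers is then a general fact.
\<close>
locale pointy_shift_action = group G
  for G :: "('g, 'm) monoid_scheme" (structure) +
  fixes S :: "'s set" and z :: 's and act :: "'g \<Rightarrow> (int \<Rightarrow> 's) \<Rightarrow> int \<Rightarrow> 's" and x0 :: "int \<Rightarrow> 's"
  assumes finite_alphabet: "finite S"
    and zero_in_alphabet: "z \<in> S"
    and continuous_act: "g \<in> carrier G \<Longrightarrow> continuous_map (full_shift S) (full_shift S) (act g)"
    and act_shift: "\<lbrakk>g \<in> carrier G; x \<in> topspace (full_shift S)\<rbrakk>
      \<Longrightarrow> act g (shift x) = shift (act g x)"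
    and act_one: "x \<in> topspace (full_shift S) \<Longrightarrow> act \<one> x = x"
    and act_mult: "\<lbrakk>g \<in> carrier G; h \<in> carrier G; x \<in> topspace (full_shift S)\<rbrakk>
      \<Longrightarrow> act (g \<otimes> h) x = act g (act h x)"
    and act_zero: "g \<in> carrier G \<Longrightarrow> act g (\<lambda>_. z) = (\<lambda>_. z)"
    and base_in: "x0 \<in> topspace (full_shift S)"
    and zero_finite_base: "zero_finite z x0"
    and free_orbit: "inj_on (\<lambda>g. act g x0) (carrier G)"
begin

lemma act_in:
  "\<lbrakk>g \<in> carrier G; x \<in> topspace (full_shift S)\<rbrakk> \<Longrightarrow> act g x \<in> topspace (full_shift S)"
  using continuous_act by (auto simp: continuous_map_def)

abbreviation aut :: "'g \<Rightarrow> (int \<Rightarrow> 's) \<Rightarrow> int \<Rightarrow> 's" where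
  "aut g \<equiv> restrict (act g) (topspace (full_shift S))"

lemma aut_in_carrier:
  assumes g: "g \<in> carrier G"
  shows "aut g \<in> carrier (aut_shift0 S z)"
proof -
  let ?X = "topspace (full_shift S)"
  have "homeomorphic_maps (full_shift S) (full_shift S) (act g) (act (inv g))"
    unfolding homeomorphic_maps_def
    using g by (auto simp: continuous_act act_one simp flip: act_mult)
  then have "homeomorphic_map (full_shift S) (full_shift S) (act g)"
    using homeomorphic_maps_map by blast
  then have hom: "homeomorphic_map (full_shift S) (full_shift S) (aut g)"
    by (rule homeomorphic_map_eq) simp
  have "aut g \<in> Bij ?X"
    using homeomorphic_imp_injective_map[OF hom] homeomorphic_imp_surjective_map[OF hom]
    by (simp add: Bij_def bij_betw_def)
  moreover have "shift x \<in> ?X" if "x \<in> ?X" for x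
    using that by (simp add: topspace_full_shift shift_def)
  ultimately show ?thesis
    using hom g act_shift act_zero zero_in_alphabet
    by (simp add: aut_shift0_def aut_shift_def stabilizer_def topspace_full_shift)
qed

lemma aut_mon: "aut \<in> mon G (aut_shift0 S z)"
proof -
  have "aut (g \<otimes> h) = aut g \<otimes>\<^bsub>aut_shift0 S z\<^esub> aut h" if "g \<in> carrier G" "h \<in> carrier G" for g h
  proof -
    have "aut g \<in> Bij (topspace (full_shift S))" "aut h \<in> Bij (topspace (full_shift S))"
      using aut_in_carrier that by (simp_all add: aut_shift0_def aut_shift_def stabilizer_def)
    then show ?thesis
      using that
      by (auto simp: aut_shift0_def aut_shift_def BijGroup_def compose_def act_mult act_in
          intro!: restrict_ext)
  qed
  moreover have "inj_on aut (carrier G)"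
    using free_orbit base_in unfolding inj_on_def by (metis restrict_apply')
  ultimately show ?thesis
    using aut_in_carrier by (simp add: mon_def hom_def)
qed

lemma pointy_aut: "pointy S z (aut ` carrier G)"
proof -
  have "group_hom G (aut_shift0 S z) aut"
    using aut_mon group_aut_shift0[OF zero_in_alphabet]
    by (simp add: group_hom_def group_hom_axioms_def is_group mon_def)
  then have "subgroup (aut ` carrier G) (aut_shift0 S z)"
    by (rule group_hom.img_is_subgroup)
  moreover have "inj_on (\<lambda>h. h x0) (aut ` carrier G)"
    using free_orbit base_in by (auto simp: inj_on_def)
  ultimately show ?thesis
    using base_in zero_finite_base unfolding pointy_def by blast
qed

text \<open>
  Conjugation with a relabelling of the symbols keeps all the required properties; this is what
  allows the alphabet to be traded for one consisting of numbers.
\<close>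
lemma rename_alphabet:
  assumes d: "\<And>s. s \<in> S \<Longrightarrow> d (e s) = s"
  shows "pointy_shift_action G (e ` S) (e z) (\<lambda>g y. e \<circ> act g (d \<circ> y)) (e \<circ> x0)"
proof -
  let ?X = "topspace (full_shift S)" and ?Y = "topspace (full_shift (e ` S))"
  have ed: "e \<circ> (d \<circ> y) = y" if "y \<in> ?Y" for y
  proof
    fix i
    have "y i \<in> e ` S" using that by (simp add: topspace_full_shift)
    then show "(e \<circ> (d \<circ> y)) i = y i" using d by auto
  qed
  have de: "d \<circ> (e \<circ> x) = x" if "x \<in> ?X" for x
    using that d by (auto simp: topspace_full_shift)
  have dY: "d \<circ> y \<in> ?X" if "y \<in> ?Y" for y
  proof -
    have "y i \<in> e ` S" for i using that by (simp add: topspace_full_shift)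
    then have "d (y i) \<in> S" for i using d by (metis imageE)
    then show ?thesis by (simp add: topspace_full_shift)
  qed
  have eX: "e \<circ> x \<in> ?Y" if "x \<in> ?X" for x
    using that by (simp add: topspace_full_shift)
  have zero: "(\<lambda>_. z) \<in> ?X" using zero_in_alphabet by (simp add: topspace_full_shift)
  have cd: "continuous_map (full_shift (e ` S)) (full_shift S) ((\<circ>) d)"
  proof (rule continuous_map_full_shift_local)
    show "(d \<circ> x) i \<in> S" if "x \<in> ?Y" for x i
      using dY[OF that] by (simp add: topspace_full_shift)
    show "\<exists>J. finite J \<and> (\<forall>x\<in>?Y. \<forall>y\<in>?Y. (\<forall>j\<in>J. x j = y j) \<longrightarrow> (d \<circ> x) i = (d \<circ> y) i)" for i
      by (rule exI[of _ "{i}"]) simp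
  qed
  have ce: "continuous_map (full_shift S) (full_shift (e ` S)) ((\<circ>) e)"
  proof (rule continuous_map_full_shift_local)
    show "(e \<circ> x) i \<in> e ` S" if "x \<in> ?X" for x i
      using that by (simp add: topspace_full_shift)
    show "\<exists>J. finite J \<and> (\<forall>x\<in>?X. \<forall>y\<in>?X. (\<forall>j\<in>J. x j = y j) \<longrightarrow> (e \<circ> x) i = (e \<circ> y) i)" for i
      by (rule exI[of _ "{i}"]) simp
  qed
  show ?thesis
  proof
    show "finite (e ` S)" using finite_alphabet by simp
    show "e z \<in> e ` S" using zero_in_alphabet by simp
    show "continuous_map (full_shift (e ` S)) (full_shift (e ` S)) (\<lambda>y. e \<circ> act g (d \<circ> y))"
      if "g \<in> carrier G" for g
      using continuous_map_compose[OF continuous_map_compose[OF cd continuous_act[OF that]] ce]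
      by (simp add: comp_def)
    show "e \<circ> act g (d \<circ> shift y) = shift (e \<circ> act g (d \<circ> y))"
      if "g \<in> carrier G" "y \<in> ?Y" for g y
    proof -
      have "e \<circ> act g (d \<circ> shift y) = e \<circ> act g (shift (d \<circ> y))"
        by (simp add: shift_def comp_def)
      then show ?thesis
        using act_shift[OF that(1) dY[OF that(2)]] by (simp add: shift_def comp_def)
    qed
    show "e \<circ> act \<one> (d \<circ> y) = y" if "y \<in> ?Y" for y
      using act_one[OF dY[OF that]] ed[OF that] by simp
    show "e \<circ> act (g \<otimes> h) (d \<circ> y) = e \<circ> act g (d \<circ> (e \<circ> act h (d \<circ> y)))"
      if "g \<in> carrier G" "h \<in> carrier G" "y \<in> ?Y" for g h y
      using act_mult[OF that(1,2) dY[OF that(3)]] de[OF act_in[OF that(2) dY[OF that(3)]]] by simp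
    show "e \<circ> act g (d \<circ> (\<lambda>_. e z)) = (\<lambda>_. e z)" if "g \<in> carrier G" for g
    proof -
      have "d \<circ> (\<lambda>_. e z) = (\<lambda>_::int. z)"
        using d[OF zero_in_alphabet] by (simp add: comp_def)
      then have "act g (d \<circ> (\<lambda>_. e z)) = (\<lambda>_. z)" using act_zero[OF that] by simp
      then show ?thesis by (simp add: comp_def)
    qed
    show "e \<circ> x0 \<in> ?Y" using eX base_in .
    have "{i. (e \<circ> x0) i \<noteq> e z} \<subseteq> {i. x0 i \<noteq> z}" by auto
    then show "zero_finite (e z) (e \<circ> x0)"
      using zero_finite_base finite_subset unfolding zero_finite_def by blast
    show "inj_on (\<lambda>g. e \<circ> act g (d \<circ> (e \<circ> x0))) (carrier G)"
    proof (rule inj_onI)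
      fix g h assume gh: "g \<in> carrier G" "h \<in> carrier G"
        and eq: "e \<circ> act g (d \<circ> (e \<circ> x0)) = e \<circ> act h (d \<circ> (e \<circ> x0))"
      have "act g x0 = d \<circ> (e \<circ> act g x0)" "act h x0 = d \<circ> (e \<circ> act h x0)"
        using de[OF act_in[OF _ base_in]] gh by simp_all
      then have "act g x0 = act h x0" using eq de[OF base_in] by simp
      then show "g = h" using free_orbit gh by (simp add: inj_on_def)
    qed
  qed
qed

theorem admits_pointy_action: "admits_pointy_action G"
proof -
  obtain e :: "'s \<Rightarrow> nat" where e: "inj_on e S"
    using finite_alphabet finite_imp_inj_to_nat_seg by metis
  interpret N: pointy_shift_action G "e ` S" "e z"
    "\<lambda>g y. e \<circ> act g (inv_into S e \<circ> y)" "e \<circ> x0"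
    by (rule rename_alphabet) (rule inv_into_f_f[OF e])
  show ?thesis
    unfolding admits_pointy_action_def
    using N.finite_alphabet N.zero_in_alphabet N.aut_mon N.pointy_aut by blast
qed

end

section \<open>The action of the wreath product\<close>

text \<open>
  The product is taken over \<open>i + j\<close> and not over \<open>i - j\<close>: then moving both the factors \<open>f\<close> and the
  marks \<open>c\<close> by \<open>k\<close> changes nothing (\<open>mark_product_translate\<close>), which is what the multiplication rule
  of the semidirect product asks for. With \<open>i - j\<close> the result would move by \<open>2 k\<close>.
\<close>
definition mark_product ::
  "('a, 'b) monoid_scheme \<Rightarrow> (int \<Rightarrow> 'a) \<Rightarrow> (int \<Rightarrow> bool) \<Rightarrow> int \<Rightarrow> 'a" where
  "mark_product A f c i = gfinprod A (\<lambda>j. if c (i + j) then f j else \<one>\<^bsub>A\<^esub>) UNIV"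

definition wreath_act ::
  "('a, 'b) monoid_scheme \<Rightarrow> (int \<Rightarrow> 'a) \<times> int \<Rightarrow> (int \<Rightarrow> 'a \<times> bool) \<Rightarrow> int \<Rightarrow> 'a \<times> bool" where
  "wreath_act A = (\<lambda>(f, k) x i.
     (fst (x i) \<otimes>\<^bsub>A\<^esub> mark_product A f (translate k (snd \<circ> x)) i, snd (x (i - k))))"

context comm_group
begin

abbreviation finsupp :: "(int \<Rightarrow> 'a) monoid" where
  "finsupp \<equiv> sum_group UNIV (\<lambda>_. G)"

lemma finsupp_carrier:
  assumes "f \<in> carrier finsupp"
  shows "f j \<in> carrier G" "finite {j. f j \<noteq> \<one>}"
  using assms is_group by (auto simp: carrier_sum_group)

lemma mark_product_closed [simp]:
  "f \<in> carrier finsupp \<Longrightarrow> mark_product G f c i \<in> carrier G"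
  using finsupp_carrier(1) by (auto simp: mark_product_def intro: gfinprod_closed)

lemma mark_product_mult:
  assumes "f \<in> carrier finsupp" "g \<in> carrier finsupp"
  shows "mark_product G (f \<otimes>\<^bsub>finsupp\<^esub> g) c i = mark_product G f c i \<otimes> mark_product G g c i"
proof -
  have "(\<lambda>f. gfinprod G (\<lambda>j. (if c (i + j) then (\<lambda>a. a) else (\<lambda>_. \<one>)) (f j)) UNIV)
      \<in> hom finsupp G"
    by (rule hom_group_sum) (auto simp: hom_def is_group)
  then have "(\<lambda>f. mark_product G f c i) \<in> hom finsupp G"
    by (simp add: mark_product_def if_distribR cong: if_cong)
  then show ?thesis
    using assms by (auto dest: hom_mult)
qed

lemma mark_product_one: "mark_product G \<one>\<^bsub>finsupp\<^esub> c i = \<one>"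
  by (simp add: mark_product_def gfinprod_def)

lemma mark_product_no_marks: "mark_product G f (\<lambda>_. False) i = \<one>"
  by (simp add: mark_product_def gfinprod_def)

text \<open>Moving the factors and the marks together only reindexes the product.\<close>
lemma mark_product_translate:
  assumes "f \<in> carrier finsupp"
  shows "mark_product G (translate k f) (translate k c) = mark_product G f c"
proof
  fix i
  let ?F = "\<lambda>j. if c (i + j) then f j else \<one>"
  let ?F' = "\<lambda>j. if translate k c (i + j) then translate k f j else \<one>"
  have F': "?F' j = ?F (j - k)" for j
    by (simp add: translate_def algebra_simps)
  have supp: "{j. ?F' j \<noteq> \<one>} = (\<lambda>j. j + k) ` {j. ?F j \<noteq> \<one>}"
    unfolding F'
  proof (intro equalityI subsetI)
    fix j assume "j \<in> {j. ?F (j - k) \<noteq> \<one>}"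
    then show "j \<in> (\<lambda>j. j + k) ` {j. ?F j \<noteq> \<one>}"
      by (intro image_eqI[of _ _ "j - k"]) simp_all
  qed (auto split: if_splits)
  have closed: "?F' \<in> (\<lambda>j. j + k) ` {j. ?F j \<noteq> \<one>} \<rightarrow> carrier G"
    using finsupp_carrier(1)[OF assms] by (auto simp: translate_def)
  have fin: "finite {j. ?F j \<noteq> \<one>}"
    by (rule finite_subset[OF _ finsupp_carrier(2)[OF assms]]) auto
  have "finprod G ?F' {j. ?F' j \<noteq> \<one>} = finprod G (\<lambda>j. ?F' (j + k)) {j. ?F j \<noteq> \<one>}"
    unfolding supp by (rule finprod_reindex[OF closed]) (simp add: inj_on_def)
  also have "\<dots> = finprod G ?F {j. ?F j \<noteq> \<one>}"
    unfolding F' by (simp only: add_diff_cancel_right')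
  finally have "finprod G ?F' {j. ?F' j \<noteq> \<one>} = finprod G ?F {j. ?F j \<noteq> \<one>}" .
  moreover have "finite {j. ?F' j \<noteq> \<one>}"
    unfolding supp using fin by simp
  ultimately show "mark_product G (translate k f) (translate k c) i = mark_product G f c i"
    using fin by (simp add: mark_product_def gfinprod_def)
qed

lemma mark_product_local:
  assumes "f \<in> carrier finsupp" and "\<And>j. f j \<noteq> \<one> \<Longrightarrow> c (i + j) = c' (i + j)"
  shows "mark_product G f c i = mark_product G f c' i"
proof -
  have "(\<lambda>j. if c (i + j) then f j else \<one>) = (\<lambda>j. if c' (i + j) then f j else \<one>)"
    using assms(2) by (intro ext) (metis (full_types))
  then show ?thesis by (simp add: mark_product_def)
qed

lemma mark_product_single:
  assumes "f \<in> carrier finsupp"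
  shows "mark_product G f (\<lambda>i. i = k) i = f (k - i)"
proof -
  have "mark_product G f (\<lambda>i. i = k) i = gfinprod G f {k - i}"
    unfolding mark_product_def
    by (rule gfinprod_mono_neutral_cong_right) (use finsupp_carrier(1)[OF assms] in auto)
  also have "\<dots> = f (k - i)"
    using finsupp_carrier(1)[OF assms] by (simp add: Pi_iff)
  finally show ?thesis .
qed

lemma translate_in_finsupp:
  assumes "f \<in> carrier finsupp"
  shows "translate k f \<in> carrier finsupp"
proof -
  have "finite ((\<lambda>j. j + k) ` {j. f j \<noteq> \<one>})"
    using finsupp_carrier(2)[OF assms] by simp
  moreover have "{j. translate k f j \<noteq> \<one>} \<subseteq> (\<lambda>j. j + k) ` {j. f j \<noteq> \<one>}"
  proof
    fix j assume "j \<in> {j. translate k f j \<noteq> \<one>}"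
    then show "j \<in> (\<lambda>j. j + k) ` {j. f j \<noteq> \<one>}"
      by (intro image_eqI[of _ _ "j - k"]) (simp_all add: translate_def)
  qed
  ultimately have "finite {j. translate k f j \<noteq> \<one>}"
    by (rule finite_subset[rotated])
  then show ?thesis
    using finsupp_carrier(1)[OF assms] is_group
    by (simp add: carrier_sum_group translate_def PiE_iff)
qed

lemma carrier_wreath_int: "carrier (wreath_int G) = carrier finsupp \<times> UNIV"
  by (simp add: wreath_int_def semidirect_product_def integer_group_def)

lemma wreath_int_cases:
  assumes "w \<in> carrier (wreath_int G)"
  obtains f k where "w = (f, k)" "f \<in> carrier finsupp"
  using assms unfolding carrier_wreath_int by blast

lemma one_wreath_int: "\<one>\<^bsub>wreath_int G\<^esub> = (\<one>\<^bsub>finsupp\<^esub>, 0)"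
  by (simp add: wreath_int_def semidirect_product_def integer_group_def)

lemma mult_wreath_int:
  "(f, k) \<otimes>\<^bsub>wreath_int G\<^esub> (g, l) = (f \<otimes>\<^bsub>finsupp\<^esub> translate k g, k + l)"
  by (simp add: wreath_int_def semidirect_product_def integer_group_def)

abbreviation wreath_point :: "int \<Rightarrow> 'a \<times> bool" where
  "wreath_point \<equiv> \<lambda>i. (\<one>, i = 0)"

text \<open>
  A single mark turns the product into a single factor, so the orbit of this point records the group
  elements in full: the second track shows \<open>k\<close>, and given \<open>k\<close>, the first shows \<open>f\<close>.
\<close>
lemma wreath_act_point:
  assumes "f \<in> carrier finsupp"
  shows "wreath_act G (f, k) wreath_point = (\<lambda>i. (f (k - i), i = k))"
proof -
  have "translate k (snd \<circ> wreath_point) = (\<lambda>i. i = k)"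
    by (auto simp: translate_def)
  then show ?thesis
    using mark_product_single[OF assms] finsupp_carrier(1)[OF assms]
    by (simp add: wreath_act_def)
qed

lemma wreath_pointy_shift_action:
  assumes fin: "finite (carrier G)"
  shows "pointy_shift_action (wreath_int G) (carrier G \<times> UNIV) (\<one>, False) (wreath_act G) wreath_point"
proof -
  let ?W = "wreath_int G" and ?S = "carrier G \<times> (UNIV :: bool set)"
  let ?X = "topspace (full_shift ?S)"
  interpret W: group ?W by (rule group_wreath_int[OF is_group])
  have X: "fst (x i) \<in> carrier G" if "x \<in> ?X" for x i
    using that by (auto simp: topspace_full_shift mem_Times_iff)
  show ?thesis
  proof
    show "finite ?S" using fin by simp
    show "(\<one>, False) \<in> ?S" by simp
    show "continuous_map (full_shift ?S) (full_shift ?S) (wreath_act G w)"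
      if w': "w \<in> carrier ?W" for w
    proof -
      obtain f k where w: "w = (f, k)" and f: "f \<in> carrier finsupp"
        using wreath_int_cases[OF w'] .
      show ?thesis unfolding w
      proof (rule continuous_map_full_shift_local)
        show "wreath_act G (f, k) x i \<in> ?S" if "x \<in> ?X" for x i
          using X[OF that] mark_product_closed[OF f] by (simp add: wreath_act_def)
        show "\<exists>J. finite J \<and> (\<forall>x\<in>?X. \<forall>y\<in>?X. (\<forall>j\<in>J. x j = y j) \<longrightarrow>
            wreath_act G (f, k) x i = wreath_act G (f, k) y i)" for i
        proof (intro exI conjI ballI impI)
          let ?J = "{i, i - k} \<union> (\<lambda>j. i + j - k) ` {j. f j \<noteq> \<one>}"
          show "finite ?J" using finsupp_carrier(2)[OF f] by simp
          fix x y :: "int \<Rightarrow> 'a \<times> bool" assume eq: "\<forall>j\<in>?J. x j = y j"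
          have "mark_product G f (translate k (snd \<circ> x)) i
              = mark_product G f (translate k (snd \<circ> y)) i"
            by (rule mark_product_local[OF f]) (use eq in \<open>auto simp: translate_def\<close>)
          then show "wreath_act G (f, k) x i = wreath_act G (f, k) y i"
            using eq by (simp add: wreath_act_def)
        qed
      qed
    qed
    show "wreath_act G w (shift x) = shift (wreath_act G w x)" for w x
      by (cases w) (simp add: wreath_act_def shift_def mark_product_def translate_def comp_def
          algebra_simps)
    show "wreath_act G \<one>\<^bsub>?W\<^esub> x = x" if "x \<in> ?X" for x
      using X[OF that] mark_product_one unfolding one_wreath_int by (simp add: wreath_act_def)
    show "wreath_act G (v \<otimes>\<^bsub>?W\<^esub> w) x = wreath_act G v (wreath_act G w x)"
      if vw: "v \<in> carrier ?W" "w \<in> carrier ?W" and x: "x \<in> ?X" for v w x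
    proof -
      obtain f k where v: "v = (f, k)" and f: "f \<in> carrier finsupp"
        using wreath_int_cases[OF vw(1)] .
      obtain g l where w: "w = (g, l)" and g: "g \<in> carrier finsupp"
        using wreath_int_cases[OF vw(2)] .
      let ?c = "snd \<circ> x"
      have c: "snd \<circ> wreath_act G (g, l) x = translate l ?c"
        by (auto simp: wreath_act_def translate_def)
      have tt: "translate (k + l) ?c = translate k (translate l ?c)"
        by (simp add: translate_def algebra_simps)
      \<comment> \<open>The factor from \<open>g\<close> comes out first, as \<open>(g, l)\<close> acts first; the two factors
        are swapped by commutativity.\<close>
      have "mark_product G (f \<otimes>\<^bsub>finsupp\<^esub> translate k g) (translate (k + l) ?c) i
          = mark_product G g (translate l ?c) i
            \<otimes> mark_product G f (translate k (translate l ?c)) i" for i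
        unfolding tt mark_product_mult[OF f translate_in_finsupp[OF g]] mark_product_translate[OF g]
        by (simp add: m_comm f g)
      then have fst: "fst (x i) \<otimes> mark_product G (f \<otimes>\<^bsub>finsupp\<^esub> translate k g) (translate (k + l) ?c) i
          = fst (wreath_act G (g, l) x i) \<otimes> mark_product G f (translate k (translate l ?c)) i" for i
        using X[OF x] f g by (simp add: wreath_act_def m_assoc)
      have snd: "snd (x (i - (k + l))) = snd (wreath_act G (g, l) x (i - k))" for i
        by (simp add: wreath_act_def algebra_simps)
      show ?thesis
        unfolding v w mult_wreath_int
        by (subst (1 2) wreath_act_def) (simp only: prod.case c fst snd)
    qed
    show "wreath_act G w (\<lambda>_. (\<one>, False)) = (\<lambda>_. (\<one>, False))" for w
    proof -
      have "translate k (snd \<circ> (\<lambda>_. (\<one>, False))) = (\<lambda>_. False)" for k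
        by (simp add: translate_def)
      then show ?thesis
        by (cases w) (simp add: wreath_act_def mark_product_no_marks)
    qed
    show "wreath_point \<in> ?X" by (simp add: topspace_full_shift)
    show "zero_finite (\<one>, False) wreath_point" by (simp add: zero_finite_def)
    show "inj_on (\<lambda>w. wreath_act G w wreath_point) (carrier ?W)"
    proof (rule inj_onI)
      fix v w assume vw: "v \<in> carrier ?W" "w \<in> carrier ?W"
        and eq: "wreath_act G v wreath_point = wreath_act G w wreath_point"
      obtain f k where v: "v = (f, k)" and f: "f \<in> carrier finsupp"
        using wreath_int_cases[OF vw(1)] .
      obtain g l where w: "w = (g, l)" and g: "g \<in> carrier finsupp"
        using wreath_int_cases[OF vw(2)] .
      have eq': "f (k - i) = g (l - i)" "i = k \<longleftrightarrow> i = l" for i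
        using fun_cong[OF eq, of i] unfolding v w wreath_act_point[OF f] wreath_act_point[OF g]
        by simp_all
      have "k = l" using eq'(2)[of k] by simp
      moreover have "f j = g j" for j using eq'(1)[of "k - j"] \<open>k = l\<close> by simp
      ultimately show "v = w" unfolding v w by auto
    qed
  qed
qed

end

theorem lemma6:
  fixes A :: "('a, 'b) monoid_scheme"
  assumes "comm_group A"
    and "finite (carrier A)"
  shows "admits_pointy_action (wreath_int A)"
  using pointy_shift_action.admits_pointy_action
    [OF comm_group.wreath_pointy_shift_action[OF assms]] .

end
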